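(* Let $H\in\mathbb{R}$, $H\neq1$, and let $X=\{X(\mu;t):\mu\in\overline\Omega,t\ge0\}$ be a centered family of stochastic processes that is self-similar with Hurst exponent $H$ and has stationary increments. Assume that $X(\mu;1)$ has finite second moments for all $\mu\in\Omega$, and let the variance function $V:\Omega\to\mathbb{R}_+$ be defined by $V(\mu)=\mathrm{Var}[X(\mu;1)]$ for $\mu\in\Omega$. Then $X(\mu;t)$ has finite second moments for all $t>0$ and $\mu\in\Omega$, and for every $\mu\in\Omega$, $$\mathrm{Var}[X(\mu;t)]=t^{2H}V(\mu t^{1-H})=:V_H(\mu;t)\quad\text{for all } t>0,$$ $$\mathrm{Cov}[X(\mu;s),X(\mu;t)]=\tfrac12\left[V_H(\mu;s)+V_H(\mu;t)-V_H(\mu;|t-s|)\right]\quad\text{for all } s,t>0.$$ Thus (for given $H$) the whole covariance structure of $X$ is expressed in terms of the variance function $V$.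
   Context: $\overline\Omega$ is an interval (possibly containing $\pm\infty$) with $\mathbb{R}_+\subseteq\overline\Omega$ and $c\,\overline\Omega\subseteq\overline\Omega$ for all $c>0$, and $\Omega$ is its interior. All processes are real-valued and defined on a common probability space. The family $X$ is self-similar with Hurst exponent $H$ if for all $c>0$ and $\mu\in\overline\Omega$, $\{X(\mu c^{H-1};ct)\}_{t\ge0}\overset d=\{c^HX(\mu;t)\}_{t\ge0}$ (equality of finite-dimensional distributions). It has stationary increments if for all $s>0$ and $\mu\in\overline\Omega$, $\{X(\mu;s+t)-X(\mu;s)\}_{t\ge0}\overset d=\{X(\mu;t)-X(\mu;0)\}_{t\ge0}$. Centered means that $\mathbb{E}[X(\mu;t)]$ is, for each $\mu\in\Omega$, linear in $t$ with no constant term, i.e. $\mathbb{E}[X(\mu;t)]=b(\mathrm{sgn}(\mu))\,|\mu|\,t$ for some function $b$ of the sign of $\mu$. In the covariance formula the term $V_H(\mu;|t-s|)$ stands for $\mathrm{Var}[X(\mu;t)-X(\mu;s)]$, which is $0$ when $s=t$.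
   Formalization: The covariance formula is proved in general with Var[X(μ;t)-X(μ;s)] as last term; with V_H(μ;|t-s|) given by V, only if X(μ;0)=0 a.s., since otherwise it fails (H=0, X(μ;t)=Z for all μ,t with mean 0, variance 1). *)

theory Defs
  imports "HOL-Probability.Probability"
begin

text \<open>
  The index domain is an interval of the extended reals. Only the strictly positive reals are
  required to lie in it, so both common readings of \<open>\<real>\<^sub>+\<close> (with or without 0) are covered.
\<close>

definition index_domain :: "ereal set \<Rightarrow> bool" where
  "index_domain D \<longleftrightarrow>
     (\<forall>x\<in>D. \<forall>z\<in>D. \<forall>y. x \<le> y \<and> y \<le> z \<longrightarrow> y \<in> D) \<and>
     (\<forall>x::real. x > 0 \<longrightarrow> ereal x \<in> D) \<and>
     (\<forall>c::real. c > 0 \<longrightarrow> (\<forall>\<mu>\<in>D. ereal c * \<mu> \<in> D))"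

text \<open>
  The interior is taken in the real line: in the topology of the extended reals an infinite
  endpoint belonging to the domain would be an interior point.
\<close>

definition domain_interior :: "ereal set \<Rightarrow> real set" where
  "domain_interior D = interior {x. ereal x \<in> D}"

text \<open>
  Equality of the finite-dimensional distributions of two processes indexed by \<open>t \<ge> 0\<close>,
  intended for processes all of whose coordinates are random variables on \<open>M\<close>.
\<close>

definition fdd_eq ::
    "'a measure \<Rightarrow> (real \<Rightarrow> 'a \<Rightarrow> real) \<Rightarrow> (real \<Rightarrow> 'a \<Rightarrow> real) \<Rightarrow> bool" where
  "fdd_eq M Y Z \<longleftrightarrow>
     (\<forall>J. finite J \<and> J \<subseteq> {0..} \<longrightarrow>
        distr M (\<Pi>\<^sub>M t\<in>J. borel) (\<lambda>\<omega>. \<lambda>t\<in>J. Y t \<omega>) =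
        distr M (\<Pi>\<^sub>M t\<in>J. borel) (\<lambda>\<omega>. \<lambda>t\<in>J. Z t \<omega>))"

definition self_similar_family ::
    "'a measure \<Rightarrow> ereal set \<Rightarrow> real \<Rightarrow> (ereal \<Rightarrow> real \<Rightarrow> 'a \<Rightarrow> real) \<Rightarrow> bool" where
  "self_similar_family M D H X \<longleftrightarrow>
     (\<forall>c>0. \<forall>\<mu>\<in>D.
        fdd_eq M (\<lambda>t. X (\<mu> * ereal (c powr (H - 1))) (c * t))
                 (\<lambda>t \<omega>. c powr H * X \<mu> t \<omega>))"

definition stationary_increments_family ::
    "'a measure \<Rightarrow> ereal set \<Rightarrow> (ereal \<Rightarrow> real \<Rightarrow> 'a \<Rightarrow> real) \<Rightarrow> bool" where
  "stationary_increments_family M D X \<longleftrightarrow>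
     (\<forall>s>0. \<forall>\<mu>\<in>D.
        fdd_eq M (\<lambda>t \<omega>. X \<mu> (s + t) \<omega> - X \<mu> s \<omega>)
                 (\<lambda>t \<omega>. X \<mu> t \<omega> - X \<mu> 0 \<omega>))"

definition centered_family ::
    "'a measure \<Rightarrow> ereal set \<Rightarrow> (ereal \<Rightarrow> real \<Rightarrow> 'a \<Rightarrow> real) \<Rightarrow> bool" where
  "centered_family M D X \<longleftrightarrow>
     (\<exists>b :: real \<Rightarrow> real. \<forall>\<mu>\<in>domain_interior D. \<forall>t\<ge>0.
        integrable M (X (ereal \<mu>) t) \<and>
        prob_space.expectation M (X (ereal \<mu>) t) = b (sgn \<mu>) * \<bar>\<mu>\<bar> * t)"

definition finite_second_moment :: "'a measure \<Rightarrow> ('a \<Rightarrow> real) \<Rightarrow> bool" where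
  "finite_second_moment M Y \<longleftrightarrow> Y \<in> borel_measurable M \<and> integrable M (\<lambda>\<omega>. (Y \<omega>)\<^sup>2)"

definition covariance :: "'a measure \<Rightarrow> ('a \<Rightarrow> real) \<Rightarrow> ('a \<Rightarrow> real) \<Rightarrow> real" where
  "covariance M Y Z =
     prob_space.expectation M (\<lambda>\<omega>. (Y \<omega> - prob_space.expectation M Y) *
                                    (Z \<omega> - prob_space.expectation M Z))"

text \<open>At \<open>t = 0\<close> this is 0 for every \<open>H\<close>, because \<open>0 powr a = 0\<close>. The variance of an
  increment over a time lag \<open>h\<close> agrees with \<open>VH H V \<mu> h\<close> when \<open>X \<mu> 0 = 0\<close> almost surely, but
  not in general: take \<open>H = 0\<close> and a process that is constant in \<open>t\<close> and \<open>\<mu>\<close>, centered with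
  variance 1.\<close>

definition VH :: "real \<Rightarrow> (real \<Rightarrow> real) \<Rightarrow> real \<Rightarrow> real \<Rightarrow> real" where
  "VH H V \<mu> t = t powr (2 * H) * V (\<mu> * t powr (1 - H))"

end

theory Submission
  imports Defs
begin

text \<open>Only one-dimensional laws matter. Self-similarity with c = t, read at time 1 and at the
  parameter \<nu> = \<mu> t^(1-H), says that X(\<mu>;t) has the law of t^H X(\<nu>;1), because \<nu>
  t^(H-1) = \<mu>. Finite second moments and the variance formula are then inherited from time 1.
  \<open>domain_interior_scale\<close> keeps \<nu> where \<open>V\<close> is given, and the lemmas
  on \<open>distr\<close> carry moments across equality in law.

  The covariance follows by polarization (\<open>covariance_polarization\<close>): it is determined
  by the variances of X(\<mu>;s), X(\<mu>;t) and their difference. Stationarity moves the difference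
  to the increment from 0 to |t-s|. That increment has variance V_H(\<mu>;|t-s|) as soon as
  X(\<mu>;0) = 0 almost surely, which is the condition under which the last formula is
  stated.\<close>

lemma fdd_eq_distr_eq:
  assumes fdd: "fdd_eq M Y Z" and t: "t \<ge> 0"
    and Y: "Y t \<in> borel_measurable M" and Z: "Z t \<in> borel_measurable M"
  shows "distr M borel (Y t) = distr M borel (Z t)"
proof -
  let ?P = "\<Pi>\<^sub>M r\<in>{t}. (borel :: real measure)"
  have eval: "(\<lambda>f. f t) \<in> ?P \<rightarrow>\<^sub>M borel"
    by (rule measurable_component_singleton) simp
  \<comment> \<open>Evaluation at \<open>t\<close> pushes the law on the one-point product forward
    to the law of the coordinate itself, so equality of the laws for \<open>J = {t}\<close> descends
    to the marginals.\<close>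
  have marginal: "distr (distr M ?P (\<lambda>\<omega>. \<lambda>r\<in>{t}. W r \<omega>)) borel (\<lambda>f. f t) = distr M borel (W t)"
    if "W t \<in> borel_measurable M" for W :: "real \<Rightarrow> 'a \<Rightarrow> real"
  proof -
    have "(\<lambda>\<omega>. \<lambda>r\<in>{t}. W r \<omega>) \<in> M \<rightarrow>\<^sub>M ?P"
      using that by (intro measurable_restrict) auto
    then show ?thesis
      by (simp add: distr_distr[OF eval] comp_def)
  qed
  have "distr M ?P (\<lambda>\<omega>. \<lambda>r\<in>{t}. Y r \<omega>) = distr M ?P (\<lambda>\<omega>. \<lambda>r\<in>{t}. Z r \<omega>)"
    using fdd t unfolding fdd_eq_def by auto
  then show ?thesis
    using marginal[of Y] marginal[of Z] Y Z by simp
qed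

lemma distr_eq_integral_eq:
  fixes Y Z :: "'a \<Rightarrow> 'b :: topological_space" and g :: "'b \<Rightarrow> real"
  assumes "distr M borel Y = distr M borel Z"
    and "Y \<in> borel_measurable M" "Z \<in> borel_measurable M" "g \<in> borel_measurable borel"
  shows "(\<integral>\<omega>. g (Y \<omega>) \<partial>M) = (\<integral>\<omega>. g (Z \<omega>) \<partial>M)"
  using assms by (metis integral_distr)

text \<open>Integrability of the square depends only on the law. The equivalence lets the second
  moment of X(\<mu>;t) be deduced from that of its rescaled copy at time 1.\<close>

lemma distr_eq_finite_second_moment_iff:
  fixes Y Z :: "'a \<Rightarrow> real"
  assumes "distr M borel Y = distr M borel Z"
    and "Y \<in> borel_measurable M" "Z \<in> borel_measurable M"
  shows "finite_second_moment M Y \<longleftrightarrow> finite_second_moment M Z"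
proof -
  have "(\<lambda>x::real. x\<^sup>2) \<in> borel_measurable borel" by simp
  then show ?thesis
    unfolding finite_second_moment_def
    using assms integrable_distr_eq[of Y M borel "\<lambda>x. x\<^sup>2"]
      integrable_distr_eq[of Z M borel "\<lambda>x. x\<^sup>2"] by simp
qed

lemma distr_eq_variance_eq:
  fixes Y Z :: "'a \<Rightarrow> real"
  assumes "prob_space M" and d: "distr M borel Y = distr M borel Z"
    and m: "Y \<in> borel_measurable M" "Z \<in> borel_measurable M"
  shows "prob_space.variance M Y = prob_space.variance M Z"
proof -
  have e: "(\<integral>\<omega>. Y \<omega> \<partial>M) = (\<integral>\<omega>. Z \<omega> \<partial>M)"
    using distr_eq_integral_eq[OF d m, of "\<lambda>x. x"] by simp
  \<comment> \<open>The means agree, so centring at the mean of \<open>Z\<close> gives one test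
    function that computes both variances.\<close>
  show ?thesis
    using distr_eq_integral_eq[OF d m, of "\<lambda>x. (x - (\<integral>\<omega>. Z \<omega> \<partial>M))\<^sup>2"] by (simp add: e)
qed

text \<open>The product is dominated by the integrable function Y^2 + Z^2.\<close>

lemma finite_second_moment_integrable_mult:
  assumes "finite_second_moment M Y" "finite_second_moment M Z"
  shows "integrable M (\<lambda>\<omega>. Y \<omega> * Z \<omega>)"
proof (rule Bochner_Integration.integrable_bound)
  show "integrable M (\<lambda>\<omega>. (Y \<omega>)\<^sup>2 + (Z \<omega>)\<^sup>2)"
    using assms by (simp add: finite_second_moment_def)
  show "(\<lambda>\<omega>. Y \<omega> * Z \<omega>) \<in> borel_measurable M"
    using assms by (auto simp: finite_second_moment_def)
  have "\<bar>x * y\<bar> \<le> x\<^sup>2 + y\<^sup>2" for x y :: real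
  proof -
    have "2 * (\<bar>x\<bar> * \<bar>y\<bar>) \<le> x\<^sup>2 + y\<^sup>2"
      using sum_squares_bound[of "\<bar>x\<bar>" "\<bar>y\<bar>"] by simp
    moreover have "0 \<le> \<bar>x\<bar> * \<bar>y\<bar>" by simp
    ultimately show ?thesis unfolding abs_mult by linarith
  qed
  then show "AE \<omega> in M. norm (Y \<omega> * Z \<omega>) \<le> norm ((Y \<omega>)\<^sup>2 + (Z \<omega>)\<^sup>2)"
    by simp
qed

lemma finite_second_moment_cmult:
  assumes "finite_second_moment M Y"
  shows "finite_second_moment M (\<lambda>\<omega>. a * Y \<omega>)"
  using assms by (auto simp: finite_second_moment_def power_mult_distrib)

lemma variance_cmult:
  fixes Y :: "'a \<Rightarrow> real"
  assumes "prob_space M"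
  shows "prob_space.variance M (\<lambda>\<omega>. a * Y \<omega>) = a\<^sup>2 * prob_space.variance M Y"
proof -
  have "(a * Y \<omega> - (\<integral>x. a * Y x \<partial>M))\<^sup>2 = a\<^sup>2 * (Y \<omega> - (\<integral>x. Y x \<partial>M))\<^sup>2" for \<omega>
    by (simp add: power_mult_distrib flip: right_diff_distrib)
  then show ?thesis by simp
qed

text \<open>For the centred variables U and W this is the expectation of 2UW = U^2 + W^2 - (W -
  U)^2. Finite second moments make each term integrable, so the expectation may be split.\<close>

lemma covariance_polarization:
  assumes "prob_space M" and Y: "finite_second_moment M Y" and Z: "finite_second_moment M Z"
  shows "covariance M Y Z =
    1/2 * (prob_space.variance M Y + prob_space.variance M Z
           - prob_space.variance M (\<lambda>\<omega>. Z \<omega> - Y \<omega>))"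
proof -
  interpret prob_space M by fact
  have [measurable]: "Y \<in> borel_measurable M" "Z \<in> borel_measurable M"
    using Y Z by (auto simp: finite_second_moment_def)
  \<comment> \<open>On a probability space square integrability implies integrability. This allows
    the mean of the difference to be split and the squares of \<open>U\<close> and \<open>W\<close>
    to be expanded.\<close>
  have [simp]: "integrable M Y" "integrable M Z"
    using Y Z by (auto simp: finite_second_moment_def intro: square_integrable_imp_integrable)
  define U where "U = (\<lambda>\<omega>. Y \<omega> - expectation Y)"
  define W where "W = (\<lambda>\<omega>. Z \<omega> - expectation Z)"
  have fU: "finite_second_moment M U" and fW: "finite_second_moment M W"
    using Y Z by (auto simp: finite_second_moment_def U_def W_def power2_diff)
  have iU: "integrable M (\<lambda>\<omega>. (U \<omega>)\<^sup>2)" and iW: "integrable M (\<lambda>\<omega>. (W \<omega>)\<^sup>2)"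
    using fU fW by (auto simp: finite_second_moment_def)
  have iUW: "integrable M (\<lambda>\<omega>. U \<omega> * W \<omega>)"
    by (rule finite_second_moment_integrable_mult[OF fU fW])
  have "variance (\<lambda>\<omega>. Z \<omega> - Y \<omega>) = expectation (\<lambda>\<omega>. ((U \<omega>)\<^sup>2 + (W \<omega>)\<^sup>2) - 2 * (U \<omega> * W \<omega>))"
    by (simp add: U_def W_def power2_eq_square algebra_simps)
  also have "\<dots> = expectation (\<lambda>\<omega>. (U \<omega>)\<^sup>2) + expectation (\<lambda>\<omega>. (W \<omega>)\<^sup>2)
      - 2 * expectation (\<lambda>\<omega>. U \<omega> * W \<omega>)"
    using iU iW iUW by simp
  finally show ?thesis
    by (simp add: covariance_def U_def W_def)
qed

lemma domain_interior_mem: "\<mu> \<in> domain_interior D \<Longrightarrow> ereal \<mu> \<in> D"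
  using interior_subset unfolding domain_interior_def by blast

text \<open>Multiplication by \<open>c > 0\<close> is a homeomorphism of the line, so it maps the
  interior to an open set. By the scaling invariance of \<open>D\<close> that set lies among the
  real points of \<open>D\<close>, hence in their interior.\<close>

lemma domain_interior_scale:
  assumes "index_domain D" and "\<mu> \<in> domain_interior D" and c: "c > 0"
  shows "\<mu> * c \<in> domain_interior D"
proof -
  let ?S = "domain_interior D"
  have "open ((*\<^sub>R) c ` ?S)"
    using c by (intro open_scaling) (auto simp: domain_interior_def)
  moreover have "(*\<^sub>R) c ` ?S \<subseteq> {x. ereal x \<in> D}"
  proof
    fix y assume "y \<in> (*\<^sub>R) c ` ?S"
    then obtain x where x: "x \<in> ?S" "y = c * x" by auto
    have "ereal c * ereal x \<in> D"
      using assms(1) c domain_interior_mem[OF x(1)] unfolding index_domain_def by blast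
    then show "y \<in> {x. ereal x \<in> D}" by (simp add: x(2))
  qed
  ultimately have "(*\<^sub>R) c ` ?S \<subseteq> ?S"
    by (simp add: domain_interior_def interior_maximal)
  then show ?thesis
    using assms(2) by (auto simp: mult.commute)
qed

theorem mainTheorem4:
  fixes M :: "'a measure" and D :: "ereal set" and H :: real
    and X :: "ereal \<Rightarrow> real \<Rightarrow> 'a \<Rightarrow> real" and V :: "real \<Rightarrow> real"
  assumes "prob_space M"
    and "index_domain D"
    and "\<And>\<mu> t. \<mu> \<in> D \<Longrightarrow> t \<ge> 0 \<Longrightarrow> X \<mu> t \<in> borel_measurable M"
    and "H \<noteq> 1"
    and "centered_family M D X"
    and "self_similar_family M D H X"
    and "stationary_increments_family M D X"
    and "\<And>\<mu>. \<mu> \<in> domain_interior D \<Longrightarrow> finite_second_moment M (X (ereal \<mu>) 1)"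
    and "\<And>\<mu>. \<mu> \<in> domain_interior D \<Longrightarrow> V \<mu> = prob_space.variance M (X (ereal \<mu>) 1)"
  shows "\<forall>\<mu>\<in>domain_interior D.
      (\<forall>t>0. finite_second_moment M (X (ereal \<mu>) t)) \<and>
      (\<forall>t>0. prob_space.variance M (X (ereal \<mu>) t) = VH H V \<mu> t) \<and>
      (\<forall>s>0. \<forall>t>0.
         covariance M (X (ereal \<mu>) s) (X (ereal \<mu>) t) =
           1/2 * (VH H V \<mu> s + VH H V \<mu> t -
                  prob_space.variance M (\<lambda>\<omega>. X (ereal \<mu>) t \<omega> - X (ereal \<mu>) s \<omega>)) \<and>
         prob_space.variance M (\<lambda>\<omega>. X (ereal \<mu>) t \<omega> - X (ereal \<mu>) s \<omega>) =
           prob_space.variance M (\<lambda>\<omega>. X (ereal \<mu>) \<bar>t - s\<bar> \<omega> - X (ereal \<mu>) 0 \<omega>) \<and>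
         ((AE \<omega> in M. X (ereal \<mu>) 0 \<omega> = 0) \<longrightarrow>
           covariance M (X (ereal \<mu>) s) (X (ereal \<mu>) t) =
             1/2 * (VH H V \<mu> s + VH H V \<mu> t - VH H V \<mu> \<bar>t - s\<bar>)))"
proof
  interpret prob_space M by fact
  fix \<mu> assume \<mu>: "\<mu> \<in> domain_interior D"
  have \<mu>D: "ereal \<mu> \<in> D" by (rule domain_interior_mem[OF \<mu>])
  have meas: "X (ereal \<mu>) t \<in> borel_measurable M" if "t \<ge> 0" for t
    using assms(3)[OF \<mu>D that] .
  have scaled: "finite_second_moment M (X (ereal \<mu>) t) \<and> variance (X (ereal \<mu>) t) = VH H V \<mu> t"
    if t: "t > 0" for t
  proof -
    \<comment> \<open>This parameter is chosen so that self-similarity with scale \<open>t\<close>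
      brings it back to \<mu>.\<close>
    define \<nu> where "\<nu> = \<mu> * t powr (1 - H)"
    have \<nu>: "\<nu> \<in> domain_interior D"
      unfolding \<nu>_def using t by (intro domain_interior_scale[OF assms(2) \<mu>]) simp
    have \<nu>D: "ereal \<nu> \<in> D" by (rule domain_interior_mem[OF \<nu>])
    have fsm: "finite_second_moment M (X (ereal \<nu>) 1)" by (rule assms(8)[OF \<nu>])
    have m\<nu>: "X (ereal \<nu>) 1 \<in> borel_measurable M" by (rule assms(3)[OF \<nu>D]) simp
    have "\<nu> * t powr (H - 1) = \<mu>"
      using t by (simp add: \<nu>_def mult.assoc flip: powr_add)
    then have index: "ereal \<nu> * ereal (t powr (H - 1)) = ereal \<mu>" by simp
    have "fdd_eq M (\<lambda>r. X (ereal \<nu> * ereal (t powr (H - 1))) (t * r))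
                   (\<lambda>r \<omega>. t powr H * X (ereal \<nu>) r \<omega>)"
      using assms(6) t \<nu>D unfolding self_similar_family_def by blast
    then have fdd: "fdd_eq M (\<lambda>r. X (ereal \<mu>) (t * r)) (\<lambda>r \<omega>. t powr H * X (ereal \<nu>) r \<omega>)"
      unfolding index .
    \<comment> \<open>Evaluation of the rescaled processes at time 1.\<close>
    have d: "distr M borel (X (ereal \<mu>) t) = distr M borel (\<lambda>\<omega>. t powr H * X (ereal \<nu>) 1 \<omega>)"
      using fdd_eq_distr_eq[OF fdd, of 1] meas[of t] m\<nu> t by simp
    have m: "X (ereal \<mu>) t \<in> borel_measurable M"
      "(\<lambda>\<omega>. t powr H * X (ereal \<nu>) 1 \<omega>) \<in> borel_measurable M"
      using meas t m\<nu> by auto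
    have "finite_second_moment M (\<lambda>\<omega>. t powr H * X (ereal \<nu>) 1 \<omega>)"
      by (rule finite_second_moment_cmult[OF fsm])
    then have fin: "finite_second_moment M (X (ereal \<mu>) t)"
      using distr_eq_finite_second_moment_iff[OF d m] by simp
    have "variance (X (ereal \<mu>) t) = variance (\<lambda>\<omega>. t powr H * X (ereal \<nu>) 1 \<omega>)"
      by (rule distr_eq_variance_eq[OF assms(1) d m])
    also have "\<dots> = (t powr H)\<^sup>2 * V \<nu>"
      unfolding variance_cmult[OF assms(1)] assms(9)[OF \<nu>] ..
    also have "(t powr H)\<^sup>2 = t powr (2 * H)"
      by (simp add: power2_eq_square flip: powr_add)
    finally show ?thesis using fin by (simp add: VH_def \<nu>_def)
  qed
  have increment: "variance (\<lambda>\<omega>. X (ereal \<mu>) t \<omega> - X (ereal \<mu>) s \<omega>) =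
      variance (\<lambda>\<omega>. X (ereal \<mu>) (t - s) \<omega> - X (ereal \<mu>) 0 \<omega>)" if "0 < s" "s \<le> t" for s t
  proof -
    have fdd: "fdd_eq M (\<lambda>r \<omega>. X (ereal \<mu>) (s + r) \<omega> - X (ereal \<mu>) s \<omega>)
                   (\<lambda>r \<omega>. X (ereal \<mu>) r \<omega> - X (ereal \<mu>) 0 \<omega>)"
      using assms(7) \<mu>D that unfolding stationary_increments_family_def by blast
    have m: "(\<lambda>\<omega>. X (ereal \<mu>) t \<omega> - X (ereal \<mu>) s \<omega>) \<in> borel_measurable M"
      "(\<lambda>\<omega>. X (ereal \<mu>) (t - s) \<omega> - X (ereal \<mu>) 0 \<omega>) \<in> borel_measurable M"
      using that by (auto intro!: borel_measurable_diff meas)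
    show ?thesis
      \<comment> \<open>The increment process started at \<open>s\<close> is read at time
        \<open>t - s\<close>; since \<open>fdd_eq\<close> includes time 0, the case
        \<open>s = t\<close> is covered.\<close>
      using fdd_eq_distr_eq[OF fdd, of "t - s"] m that
      by (intro distr_eq_variance_eq[OF assms(1) _ m]) simp
  qed
  \<comment> \<open>Stationarity only treats increments running forward in time; symmetry of the
    variance under a change of sign supplies the case \<open>t < s\<close>.\<close>
  have flip: "variance (\<lambda>\<omega>. Y \<omega> - Z \<omega>) = variance (\<lambda>\<omega>. Z \<omega> - Y \<omega>)" for Y Z :: "'a \<Rightarrow> real"
  proof -
    have "expectation (\<lambda>\<omega>. Y \<omega> - Z \<omega>) = - expectation (\<lambda>\<omega>. Z \<omega> - Y \<omega>)"
      by (simp flip: integral_minus)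
    then show ?thesis
      by (auto intro!: Bochner_Integration.integral_cong simp: power2_eq_square algebra_simps)
  qed
  have abs_increment: "variance (\<lambda>\<omega>. X (ereal \<mu>) t \<omega> - X (ereal \<mu>) s \<omega>) =
      variance (\<lambda>\<omega>. X (ereal \<mu>) \<bar>t - s\<bar> \<omega> - X (ereal \<mu>) 0 \<omega>)" if "0 < s" "0 < t" for s t
    using increment[of s t] increment[of t s] that
      flip[of "X (ereal \<mu>) t" "X (ereal \<mu>) s"] by (cases "s \<le> t") (auto simp: abs_if)
  have cov: "covariance M (X (ereal \<mu>) s) (X (ereal \<mu>) t) =
      1/2 * (VH H V \<mu> s + VH H V \<mu> t - variance (\<lambda>\<omega>. X (ereal \<mu>) t \<omega> - X (ereal \<mu>) s \<omega>))"
    if "0 < s" "0 < t" for s t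
    using covariance_polarization[OF assms(1)] scaled that by simp
  have pinned: "variance (\<lambda>\<omega>. X (ereal \<mu>) h \<omega> - X (ereal \<mu>) 0 \<omega>) = VH H V \<mu> h"
    if zero: "AE \<omega> in M. X (ereal \<mu>) 0 \<omega> = 0" and h: "h \<ge> 0" for h
  \<comment> \<open>The scaling argument needs a positive time. At \<open>h = 0\<close> both sides
    vanish: the increment is identically 0, and \<open>0 powr (2 * H) = 0\<close> for every
    \<open>H\<close>, including \<open>H = 0\<close>.\<close>
  proof (cases "h = 0")
    case True
    then show ?thesis by (simp add: VH_def)
  next
    case False
    then have "h > 0" using h by simp
    have m: "X (ereal \<mu>) h \<in> borel_measurable M" "X (ereal \<mu>) 0 \<in> borel_measurable M"
      using meas h by auto
    \<comment> \<open>Subtracting an almost surely zero variable changes neither the mean nor, in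
      the next step, the integral of the centred square.\<close>
    have e: "expectation (\<lambda>\<omega>. X (ereal \<mu>) h \<omega> - X (ereal \<mu>) 0 \<omega>) = expectation (X (ereal \<mu>) h)"
      using m zero by (intro integral_cong_AE) auto
    have "variance (\<lambda>\<omega>. X (ereal \<mu>) h \<omega> - X (ereal \<mu>) 0 \<omega>) = variance (X (ereal \<mu>) h)"
      unfolding e using m zero by (intro integral_cong_AE) auto
    then show ?thesis using scaled[OF \<open>h > 0\<close>] by simp
  qed
  show "(\<forall>t>0. finite_second_moment M (X (ereal \<mu>) t)) \<and>
      (\<forall>t>0. variance (X (ereal \<mu>) t) = VH H V \<mu> t) \<and>
      (\<forall>s>0. \<forall>t>0.
         covariance M (X (ereal \<mu>) s) (X (ereal \<mu>) t) =
           1/2 * (VH H V \<mu> s + VH H V \<mu> t -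
                  variance (\<lambda>\<omega>. X (ereal \<mu>) t \<omega> - X (ereal \<mu>) s \<omega>)) \<and>
         variance (\<lambda>\<omega>. X (ereal \<mu>) t \<omega> - X (ereal \<mu>) s \<omega>) =
           variance (\<lambda>\<omega>. X (ereal \<mu>) \<bar>t - s\<bar> \<omega> - X (ereal \<mu>) 0 \<omega>) \<and>
         ((AE \<omega> in M. X (ereal \<mu>) 0 \<omega> = 0) \<longrightarrow>
           covariance M (X (ereal \<mu>) s) (X (ereal \<mu>) t) =
             1/2 * (VH H V \<mu> s + VH H V \<mu> t - VH H V \<mu> \<bar>t - s\<bar>)))"
  proof (intro conjI allI impI)
    fix s t :: real
    assume st: "0 < s" "0 < t" and "AE \<omega> in M. X (ereal \<mu>) 0 \<omega> = 0"
    then have "variance (\<lambda>\<omega>. X (ereal \<mu>) t \<omega> - X (ereal \<mu>) s \<omega>) = VH H V \<mu> \<bar>t - s\<bar>"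
      using pinned[of "\<bar>t - s\<bar>"] abs_increment[OF st] by simp
    then show "covariance M (X (ereal \<mu>) s) (X (ereal \<mu>) t) =
        1/2 * (VH H V \<mu> s + VH H V \<mu> t - VH H V \<mu> \<bar>t - s\<bar>)"
      using cov[OF st] by simp
  qed (use scaled cov abs_increment in blast)+
qed

end
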